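(* Let $\mathrm{SoftRoVR}$ denote either the converged SoftRoVR map on $\mathbb R^T$ or its version with any fixed number of equivariantly initialized solver steps (both defined in the context). Then for every $\ell\in\mathbb R^T$ and $a\in\mathbb R$, $$\mathrm{SoftRoVR}(\ell+a\mathbf 1)=\mathrm{SoftRoVR}(\ell)+a,$$ and at every $\ell$ at which the map is differentiable, $$\sum_{t=1}^T\frac{\partial\,\mathrm{SoftRoVR}(\ell)}{\partial\ell_t}=1.$$ Moreover, let $\widehat m,m^\star\in\mathbb R$ and $e_m\ge0$ satisfy $|\widehat m-m^\star|\le e_m$, and set $\widehat q=e^{\widehat m}$, $q^\star=e^{m^\star}$. Then $e^{-e_m}\le\widehat q/q^\star\le e^{e_m}$, and for clipping bounds $0<l<u$ the clipping branch of $\widehat q$ can differ from that of $q^\star$ only if $\operatorname{dist}(m^\star,\{\log l,\log u\})\le e_m$.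
   Context: Score: for $c>0$, $\rho_c(u)=\sqrt{1+(u/c)^2}-1$, $\psi_c=\frac{u}{c^2}(1+u^2/c^2)^{-1/2}$, $\psi_c'(u)=\frac1{c^2}(1+u^2/c^2)^{-3/2}$. Converged SoftRoVR map with temperature $\gamma>0$ and smoothing $\eta>0$: the coordinates $\ell_1,\dots,\ell_T$ are partitioned into $B\ge1$ fixed nonempty balanced blocks $\mathcal H_b$ of sizes $n_b$ ($|n_b-n_{b'}|\le1$). Let $\widetilde\mu_b$ be the unique minimizer of $u\mapsto\frac1{n_b}\sum_{i\in\mathcal H_b}\rho_c(\ell_i-u)$. The smooth median is $\operatorname{smed}_\eta(v_1,\dots,v_B)=\arg\min_u\frac1B\sum_b\rho_\eta(v_b-u)$. Set $\widehat\mu_0=\operatorname{smed}_\eta(\widetilde\mu_1,\dots,\widetilde\mu_B)$. With constants $a_{\min}>0$, $0<\nu_{\min}\le\nu_{\max}$, let $\widehat\nu_b=\sqrt{\frac1{n_b}\sum_{i\in\mathcal H_b}\psi_c^2(\ell_i-\widetilde\mu_b)}\Big/\max\{\frac1{n_b}\sum_{i\in\mathcal H_b}\psi_c'(\ell_i-\widetilde\mu_b),a_{\min}\}$ and let $\widehat\nu$ be $\operatorname{smed}_\eta(\widehat\nu_1,\dots,\widehat\nu_B)$ clipped to $[\nu_{\min},\nu_{\max}]$. For an integer $K\ge1$ put $\tau_k=k/(K+1)$, $\Delta_k=\Phi^{-1}(\tau_k)$, $D_K=\sum_k\phi(\Delta_k)$, $W_B=\sum_b\sqrt{n_b}$, $H_\gamma(u)=1/(1+e^{u/\gamma})$.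 Then $$\mathrm{SoftRoVR}(\ell)=\widehat\mu_0-\frac{\widehat\nu}{D_KW_B}\sum_{b=1}^B\sum_{k=1}^K\Big[H_\gamma\Big(\widetilde\mu_b-\widehat\mu_0-\frac{\widehat\nu\Delta_k}{\sqrt{n_b}}\Big)-\tau_k\Big].$$ Finite-step version: the exact minimizers defining $\widetilde\mu_b$ and the smooth medians are replaced by the output of a fixed number $S$ of iterations of a solver (safeguarded Newton/bisection) for the corresponding score equation; "equivariantly initialized" means that the solver's starting value (and bracket), and hence each iterate, shifts by $a$ when all of the solver's inputs are shifted by $a$. The rest of the formula is unchanged. Clipping branch of $q=e^m$ for the clipping interval $[l,u]$: which of the regions cut out by the boundaries $\log l$ and $\log u$ contains $m$, i.e. $m<\log l$, $\log l\le m\le\log u$, or $m>\log u$. *)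

theory Defs
  imports "HOL-Probability.Probability"
begin

definition rho :: "real \<Rightarrow> real \<Rightarrow> real" where
  "rho c u = sqrt (1 + (u / c)\<^sup>2) - 1"

definition psi :: "real \<Rightarrow> real \<Rightarrow> real" where
  "psi c u = u / c\<^sup>2 * (1 + u\<^sup>2 / c\<^sup>2) powr (- 1 / 2)"

definition psi_deriv :: "real \<Rightarrow> real \<Rightarrow> real" where
  "psi_deriv c u = 1 / c\<^sup>2 * (1 + u\<^sup>2 / c\<^sup>2) powr (- 3 / 2)"

definition mean_over :: "'i set \<Rightarrow> ('i \<Rightarrow> real) \<Rightarrow> real" where
  "mean_over A f = (\<Sum>i\<in>A. f i) / real (card A)"

text \<open>For finite nonempty \<open>A\<close> and \<open>c > 0\<close> the objective is strictly convex and coercive, so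
  the description is proper. Only the values of \<open>v\<close> on \<open>A\<close> matter.\<close>

definition m_location :: "real \<Rightarrow> 'i set \<Rightarrow> ('i \<Rightarrow> real) \<Rightarrow> real" where
  "m_location c A v = (THE u. is_arg_min (\<lambda>u. mean_over A (\<lambda>i. rho c (v i - u))) (\<lambda>_. True) u)"

definition smed :: "real \<Rightarrow> nat \<Rightarrow> (nat \<Rightarrow> real) \<Rightarrow> real" where
  "smed \<eta> B v = m_location \<eta> {1..B} v"

definition block_scale :: "real \<Rightarrow> real \<Rightarrow> 'i set \<Rightarrow> ('i \<Rightarrow> real) \<Rightarrow> real \<Rightarrow> real" where
  "block_scale c a_min A v m =
     sqrt (mean_over A (\<lambda>i. (psi c (v i - m))\<^sup>2)) /
     max (mean_over A (\<lambda>i. psi_deriv c (v i - m))) a_min"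

definition clip :: "real \<Rightarrow> real \<Rightarrow> real \<Rightarrow> real" where
  "clip lo hi x = max lo (min hi x)"

definition normal_quantile :: "real \<Rightarrow> real" where
  "normal_quantile \<tau> = (THE x. cdf std_normal_distribution x = \<tau>)"

definition logistic_step :: "real \<Rightarrow> real \<Rightarrow> real" where
  "logistic_step \<gamma> u = 1 / (1 + exp (u / \<gamma>))"

text \<open>The part of the formula shared by the converged and the finite-step map. The arguments
  \<open>loc b\<close> (location of block \<open>b\<close>), \<open>med\<^sub>\<mu>\<close> and \<open>med\<^sub>\<nu>\<close> (smooth medians of the block locations
  and of the block scales) are either the exact minimizers or solver outputs.\<close>

definition rovr_formula ::
  "real \<Rightarrow> real \<Rightarrow> real \<Rightarrow> real \<Rightarrow> real \<Rightarrow> nat \<Rightarrow> (nat \<Rightarrow> 't set) \<Rightarrow> nat \<Rightarrow>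
   (nat \<Rightarrow> ('t \<Rightarrow> real) \<Rightarrow> real) \<Rightarrow> ((nat \<Rightarrow> real) \<Rightarrow> real) \<Rightarrow> ((nat \<Rightarrow> real) \<Rightarrow> real) \<Rightarrow>
   real ^ 't \<Rightarrow> real" where
  "rovr_formula c \<gamma> a_min \<nu>_min \<nu>_max B H K loc med\<^sub>\<mu> med\<^sub>\<nu> \<l> =
    (let n = (\<lambda>b. real (card (H b)));
         \<mu> = (\<lambda>b. loc b (vec_nth \<l>));
         \<mu>\<^sub>0 = med\<^sub>\<mu> \<mu>;
         \<nu> = clip \<nu>_min \<nu>_max (med\<^sub>\<nu> (\<lambda>b. block_scale c a_min (H b) (vec_nth \<l>) (\<mu> b)));
         \<tau> = (\<lambda>k. real k / (real K + 1));
         \<Delta> = (\<lambda>k. normal_quantile (\<tau> k));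
         D = (\<Sum>k=1..K. std_normal_density (\<Delta> k));
         W = (\<Sum>b=1..B. sqrt (n b))
     in \<mu>\<^sub>0 - \<nu> / (D * W) *
          (\<Sum>b=1..B. \<Sum>k=1..K. logistic_step \<gamma> (\<mu> b - \<mu>\<^sub>0 - \<nu> * \<Delta> k / sqrt (n b)) - \<tau> k))"

definition SoftRoVR ::
  "real \<Rightarrow> real \<Rightarrow> real \<Rightarrow> real \<Rightarrow> real \<Rightarrow> real \<Rightarrow> nat \<Rightarrow> (nat \<Rightarrow> 't set) \<Rightarrow> nat \<Rightarrow>
   real ^ 't \<Rightarrow> real" where
  "SoftRoVR c \<gamma> \<eta> a_min \<nu>_min \<nu>_max B H K =
     rovr_formula c \<gamma> a_min \<nu>_min \<nu>_max B H K (\<lambda>b. m_location c (H b)) (smed \<eta> B) (smed \<eta> B)"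

text \<open>Safeguarded Newton/bisection for the score equation
  \<open>mean_over A (\<lambda>i. psi c (v i - u)) = 0\<close>, whose left-hand side is decreasing in \<open>u\<close>. A state
  is \<open>(lo, hi, u)\<close>: the bracket and the current iterate. The bracket is first cut at \<open>u\<close>
  according to the sign of the score. The Newton point is accepted if it lies in the new bracket
  and passes the test \<open>acc\<close>; otherwise the bracket is bisected. The test stands for any
  further acceptance criterion of the solver (\<open>\<lambda>_ _ _. True\<close> for none): it sees the bracket
  ends relative to \<open>u\<close> and the score as a function of the displacement from \<open>u\<close>.\<close>

type_synonym solver_state = "real \<times> real \<times> real"

definition solver_step ::
  "(real \<Rightarrow> real \<Rightarrow> (real \<Rightarrow> real) \<Rightarrow> bool) \<Rightarrow> real \<Rightarrow> 'i set \<Rightarrow> ('i \<Rightarrow> real) \<Rightarrow>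
   solver_state \<Rightarrow> solver_state" where
  "solver_step acc c A v = (\<lambda>(lo, hi, u).
     let score = (\<lambda>x. mean_over A (\<lambda>i. psi c (v i - x)));
         lo' = (if score u \<ge> 0 then u else lo);
         hi' = (if score u \<le> 0 then u else hi);
         newton = u + score u / mean_over A (\<lambda>i. psi_deriv c (v i - u))
     in (lo', hi',
         if newton \<in> {lo'..hi'} \<and> acc (lo' - u) (hi' - u) (\<lambda>h. score (u + h))
         then newton else (lo' + hi') / 2))"

primrec solver_iterate ::
  "(nat \<Rightarrow> real \<Rightarrow> real \<Rightarrow> (real \<Rightarrow> real) \<Rightarrow> bool) \<Rightarrow> real \<Rightarrow> 'i set \<Rightarrow> ('i \<Rightarrow> real) \<Rightarrow>
   solver_state \<Rightarrow> nat \<Rightarrow> solver_state" where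
  "solver_iterate acc c A v s 0 = s"
| "solver_iterate acc c A v s (Suc j) = solver_step (acc j) c A v (solver_iterate acc c A v s j)"

definition solver ::
  "(nat \<Rightarrow> real \<Rightarrow> real \<Rightarrow> (real \<Rightarrow> real) \<Rightarrow> bool) \<Rightarrow> nat \<Rightarrow> (('i \<Rightarrow> real) \<Rightarrow> solver_state) \<Rightarrow>
   real \<Rightarrow> 'i set \<Rightarrow> ('i \<Rightarrow> real) \<Rightarrow> real" where
  "solver acc S init c A v = snd (snd (solver_iterate acc c A v (init v) S))"

text \<open>The solver's inputs are the values of \<open>v\<close> on \<open>A\<close>; taking \<open>a = 0\<close> shows that the
  initial state depends on nothing else.\<close>

definition equivariant_init :: "'i set \<Rightarrow> (('i \<Rightarrow> real) \<Rightarrow> solver_state) \<Rightarrow> bool" where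
  "equivariant_init A init \<longleftrightarrow>
     (\<forall>v w a. (\<forall>i\<in>A. w i = v i + a) \<longrightarrow>
        init w = (case init v of (lo, hi, u) \<Rightarrow> (lo + a, hi + a, u + a)))"

definition SoftRoVR_finite ::
  "nat \<Rightarrow> (nat \<Rightarrow> real \<Rightarrow> real \<Rightarrow> (real \<Rightarrow> real) \<Rightarrow> bool) \<Rightarrow>
   (nat \<Rightarrow> ('t \<Rightarrow> real) \<Rightarrow> solver_state) \<Rightarrow> ((nat \<Rightarrow> real) \<Rightarrow> solver_state) \<Rightarrow>
   ((nat \<Rightarrow> real) \<Rightarrow> solver_state) \<Rightarrow>
   real \<Rightarrow> real \<Rightarrow> real \<Rightarrow> real \<Rightarrow> real \<Rightarrow> real \<Rightarrow> nat \<Rightarrow> (nat \<Rightarrow> 't set) \<Rightarrow> nat \<Rightarrow>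
   real ^ 't \<Rightarrow> real" where
  "SoftRoVR_finite S acc init_loc init\<^sub>\<mu> init\<^sub>\<nu> c \<gamma> \<eta> a_min \<nu>_min \<nu>_max B H K =
     rovr_formula c \<gamma> a_min \<nu>_min \<nu>_max B H K
       (\<lambda>b. solver acc S (init_loc b) c (H b))
       (solver acc S init\<^sub>\<mu> \<eta> {1..B})
       (solver acc S init\<^sub>\<nu> \<eta> {1..B})"

definition balanced_blocks :: "nat \<Rightarrow> (nat \<Rightarrow> 't set) \<Rightarrow> bool" where
  "balanced_blocks B H \<longleftrightarrow>
     (\<Union>b\<in>{1..B}. H b) = UNIV \<and> disjoint_family_on H {1..B} \<and>
     (\<forall>b\<in>{1..B}. H b \<noteq> {}) \<and>
     (\<forall>b\<in>{1..B}. \<forall>b'\<in>{1..B}. \<bar>int (card (H b)) - int (card (H b'))\<bar> \<le> 1)"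

definition partial_deriv :: "(real ^ 't \<Rightarrow> real) \<Rightarrow> 't \<Rightarrow> real ^ 't \<Rightarrow> real" where
  "partial_deriv F t x = deriv (\<lambda>s. F (x + s *\<^sub>R axis t 1)) 0"

datatype clip_region = Below | Within | Above

text \<open>Stated for \<open>q > 0\<close>; the region is that of \<open>m = ln q\<close>.\<close>

definition clip_branch :: "real \<Rightarrow> real \<Rightarrow> real \<Rightarrow> clip_region" where
  "clip_branch l u q =
     (if ln q < ln l then Below else if ln q \<le> ln u then Within else Above)"

end

theory Submission
  imports Defs
begin

text \<open>All block locations and both smooth medians, exact or computed by the solver, commute with
  adding a constant to their inputs. The block scales see only the residuals, hence are invariant,
  and so are the clipped scale and the arguments of the logistic steps; thus only the leading
  \<open>\<mu>\<^sub>0\<close> moves. Differentiating the equivariance along the all-ones direction gives the sum of the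
  partial derivatives.\<close>

text \<open>The relation between \<open>w\<close> and \<open>v\<close> is demanded on
  \<open>A\<close> only. The case \<open>a = 0\<close> therefore says that \<open>f\<close> depends
  on nothing but the values on \<open>A\<close>, which takes care of block indices outside
  \<open>{1..B}\<close>.\<close>

definition shift_equivariant :: "'i set \<Rightarrow> (('i \<Rightarrow> real) \<Rightarrow> real) \<Rightarrow> bool" where
  "shift_equivariant A f \<longleftrightarrow> (\<forall>v w a. (\<forall>i\<in>A. w i = v i + a) \<longrightarrow> f w = f v + a)"

lemma shift_equivariantD:
  "shift_equivariant A f \<Longrightarrow> (\<And>i. i \<in> A \<Longrightarrow> w i = v i + a) \<Longrightarrow> f w = f v + a"
  unfolding shift_equivariant_def by blast

lemma shift_equivariant_cong:
  "shift_equivariant A f \<Longrightarrow> (\<And>i. i \<in> A \<Longrightarrow> w i = v i) \<Longrightarrow> f w = f v"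
  using shift_equivariantD[of A f w v 0] by simp

lemma mean_over_cong: "(\<And>i. i \<in> A \<Longrightarrow> f i = g i) \<Longrightarrow> mean_over A f = mean_over A g"
  unfolding mean_over_def by (simp cong: sum.cong)

section \<open>Exact minimizers: existence, uniqueness and shift equivariance\<close>

lemma rho_abs_mono: "\<bar>x\<bar> \<le> \<bar>y\<bar> \<Longrightarrow> rho c x \<le> rho c y"
  unfolding rho_def by (simp add: power_divide divide_right_mono abs_le_square_iff)

text \<open>\<open>sqrt (1 + s^2)\<close> is the Euclidean norm of \<open>(1, s)\<close>, so this is
  the strict triangle inequality for \<open>(1, s)\<close> and \<open>(1, t)\<close>, which are not
  parallel when \<open>s\<close> and \<open>t\<close> differ.\<close>

lemma rho_strict_midpoint_convex:
  assumes "c > 0" "x \<noteq> y"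
  shows "2 * rho c ((x + y) / 2) < rho c x + rho c y"
proof -
  define s t where "s = x / c" and "t = y / c"
  define p q where "p = sqrt (1 + s\<^sup>2)" and "q = sqrt (1 + t\<^sup>2)"
  have st: "s \<noteq> t" using assms by (simp add: s_def t_def)
  have p: "p \<ge> 0" "p\<^sup>2 = 1 + s\<^sup>2" and q: "q \<ge> 0" "q\<^sup>2 = 1 + t\<^sup>2"
    by (auto simp: p_def q_def)
  \<comment> \<open>Lagrange's identity for \<open>(1, s)\<close> and \<open>(1, t)\<close>: the
    squared determinant \<open>(s - t)^2\<close> makes Cauchy-Schwarz strict.\<close>
  have "(p * q)\<^sup>2 = (1 + s * t)\<^sup>2 + (s - t)\<^sup>2"
    unfolding power_mult_distrib p q by (simp add: power2_eq_square algebra_simps)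
  moreover have "(s - t)\<^sup>2 > 0" using st by simp
  ultimately have "(1 + s * t)\<^sup>2 < (p * q)\<^sup>2" by linarith
  then have "1 + s * t < p * q"
    using p q by (meson mult_nonneg_nonneg power2_less_imp_less)
  moreover have "4 * (1 + ((s + t) / 2)\<^sup>2) = 4 + s\<^sup>2 + t\<^sup>2 + 2 * (s * t)"
    by (simp add: power2_eq_square field_simps)
  moreover have "(p + q)\<^sup>2 = 2 + s\<^sup>2 + t\<^sup>2 + 2 * (p * q)"
    using p q by (simp add: power2_sum)
  ultimately have "4 * (1 + ((s + t) / 2)\<^sup>2) < (p + q)\<^sup>2" by linarith
  then have "sqrt (2\<^sup>2 * (1 + ((s + t) / 2)\<^sup>2)) < p + q"
    using p q by (intro real_less_lsqrt) auto
  then have "2 * sqrt (1 + ((s + t) / 2)\<^sup>2) < p + q"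
    by (simp only: real_sqrt_mult) simp
  moreover have "(x + y) / 2 / c = (s + t) / 2"
    by (simp add: s_def t_def add_divide_distrib)
  then have "rho c ((x + y) / 2) = sqrt (1 + ((s + t) / 2)\<^sup>2) - 1"
    by (simp only: rho_def)
  moreover have "rho c x = p - 1" "rho c y = q - 1"
    by (simp_all add: rho_def p_def q_def s_def t_def)
  ultimately show ?thesis by simp
qed

text \<open>Justifies the \<open>THE\<close> in \<open>m_location\<close>. Continuity gives a
  minimizer on the compact range of the data; clamping to that range never raises the objective, so
  this minimizer is global; strict convexity excludes a second one.\<close>

lemma m_location_ex1:
  fixes v :: "'i \<Rightarrow> real"
  assumes "c > 0" "finite A" "A \<noteq> {}"
  shows "\<exists>!u. is_arg_min (\<lambda>u. mean_over A (\<lambda>i. rho c (v i - u))) (\<lambda>_. True) u"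
proof -
  define f where "f = (\<lambda>u. mean_over A (\<lambda>i. rho c (v i - u)))"
  define lo hi where "lo = Min (v ` A)" and "hi = Max (v ` A)"
  have bounds: "lo \<le> v i" "v i \<le> hi" if "i \<in> A" for i
    using that assms by (auto simp: lo_def hi_def)
  have lohi: "lo \<le> hi" using bounds assms by (meson all_not_in_conv order_trans)
  have "continuous_on {lo..hi} f"
    unfolding f_def mean_over_def rho_def using assms by (intro continuous_intros) auto
  then obtain m where m: "m \<in> {lo..hi}" "\<And>u. u \<in> {lo..hi} \<Longrightarrow> f m \<le> f u"
    using continuous_attains_inf[of "{lo..hi}" f] lohi by auto
  \<comment> \<open>Each \<open>v i\<close> lies in \<open>{lo..hi}\<close>, so clamping
    \<open>u\<close> brings it no further from any \<open>v i\<close>.\<close>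
  have clamp: "f (clip lo hi u) \<le> f u" for u
    unfolding f_def mean_over_def
    by (intro divide_right_mono sum_mono rho_abs_mono) (use bounds in \<open>force simp: clip_def\<close>)+
  have min: "f m \<le> f u" for u
    using m(2)[of "clip lo hi u"] clamp[of u] lohi by (simp add: clip_def)
  have uniq: "u = m" if "\<And>x. f u \<le> f x" for u
  proof (rule ccontr)
    assume "u \<noteq> m"
    \<comment> \<open>Summed over \<open>A\<close>, this puts the objective at the midpoint of
      \<open>u\<close> and \<open>m\<close> strictly below the average of two minimal
      values.\<close>
    have "2 * rho c (v i - (u + m) / 2) < rho c (v i - u) + rho c (v i - m)" for i
    proof -
      have "((v i - u) + (v i - m)) / 2 = v i - (u + m) / 2" by (simp add: field_simps)
      then show ?thesis
        using rho_strict_midpoint_convex[of c "v i - u" "v i - m"] assms(1) \<open>u \<noteq> m\<close>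
        by (metis diff_left_imp_eq)
    qed
    then have "(\<Sum>i\<in>A. 2 * rho c (v i - (u + m) / 2)) < (\<Sum>i\<in>A. rho c (v i - u) + rho c (v i - m))"
      using assms by (intro sum_strict_mono) auto
    then have "2 * f ((u + m) / 2) < f u + f m"
      using assms by (simp add: f_def mean_over_def sum_distrib_left[symmetric] sum.distrib
          divide_strict_right_mono card_gt_0_iff flip: add_divide_distrib)
    then show False using that[of "(u + m) / 2"] min[of "(u + m) / 2"] by linarith
  qed
  have "\<exists>!u. is_arg_min f (\<lambda>_. True) u"
    unfolding is_arg_min_linorder using min uniq by (intro ex1I[of _ m]) blast+
  then show ?thesis by (simp add: f_def)
qed

text \<open>Replacing \<open>u\<close> by \<open>u - a\<close> carries the objective of
  \<open>w\<close> to that of \<open>v\<close>, so the translated minimizer of \<open>v\<close>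
  minimizes for \<open>w\<close>; uniqueness identifies it with the value that \<open>THE\<close>
  selects.\<close>

lemma shift_equivariant_m_location:
  fixes A :: "'i set"
  assumes "c > 0" "finite A" "A \<noteq> {}"
  shows "shift_equivariant A (m_location c A)"
  unfolding shift_equivariant_def
proof (intro allI impI)
  fix v w :: "'i \<Rightarrow> real" and a
  assume w: "\<forall>i\<in>A. w i = v i + a"
  define P where "P = (\<lambda>v u. is_arg_min (\<lambda>u. mean_over A (\<lambda>i. rho c (v i - u))) (\<lambda>_. True) u)"
  have ex1: "\<exists>!u. P v u" for v
    unfolding P_def by (rule m_location_ex1[OF assms])
  have obj: "mean_over A (\<lambda>i. rho c (w i - u)) = mean_over A (\<lambda>i. rho c (v i - (u - a)))" for u
    by (rule mean_over_cong) (use w in \<open>simp add: algebra_simps\<close>)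
  have "P v (m_location c A v)"
    using theI'[OF ex1] by (simp add: P_def m_location_def)
  then have "P w (m_location c A v + a)"
    by (simp add: P_def obj is_arg_min_linorder)
  then show "m_location c A w = m_location c A v + a"
    using the1_equality[OF ex1] by (simp add: P_def m_location_def)
qed

section \<open>Shift equivariance of the finite-step solver\<close>

lemma solver_step_shift:
  assumes w: "\<And>i. i \<in> A \<Longrightarrow> w i = v i + a"
    and "solver_step acc c A v (lo, hi, u) = (lo', hi', u')"
  shows "solver_step acc c A w (lo + a, hi + a, u + a) = (lo' + a, hi' + a, u' + a)"
proof -
  \<comment> \<open>The score and the Newton denominator see only residuals, so the sign tests that
    cut the bracket and the Newton increment are unchanged.\<close>
  have score: "mean_over A (\<lambda>i. psi c (w i - (x + a))) = mean_over A (\<lambda>i. psi c (v i - x))"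
    and score_deriv:
      "mean_over A (\<lambda>i. psi_deriv c (w i - (x + a))) = mean_over A (\<lambda>i. psi_deriv c (v i - x))" for x
    by (rule mean_over_cong, simp add: w)+
  \<comment> \<open>The test \<open>acc\<close> receives the score as a function of the displacement
    from the iterate, so equality is required for every \<open>h\<close>.\<close>
  have displaced: "mean_over A (\<lambda>i. psi c (w i - (u + a + h))) = mean_over A (\<lambda>i. psi c (v i - (u + h)))" for h
    using score[of "u + h"] by (simp add: add_ac)
  \<comment> \<open>The bracket comparisons are translated on both sides, and the bisection point
    moves by \<open>a\<close> because both ends do.\<close>
  show ?thesis
    using assms(2) unfolding solver_step_def Let_def prod.case displaced score score_deriv
    by (auto simp: field_simps split: if_splits)
qed

lemma solver_iterate_shift:
  assumes w: "\<And>i. i \<in> A \<Longrightarrow> w i = v i + a"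
    and "solver_iterate acc c A v (lo, hi, u) j = (lo', hi', u')"
  shows "solver_iterate acc c A w (lo + a, hi + a, u + a) j = (lo' + a, hi' + a, u' + a)"
  using assms(2)
proof (induction j arbitrary: lo' hi' u')
  case (Suc j)
  obtain lo1 hi1 u1 where "solver_iterate acc c A v (lo, hi, u) j = (lo1, hi1, u1)"
    by (metis prod_cases3)
  with Suc solver_step_shift[OF w] show ?case by simp
qed simp

lemma shift_equivariant_solver:
  fixes A :: "'i set"
  assumes "equivariant_init A init"
  shows "shift_equivariant A (solver acc S init c A)"
  unfolding shift_equivariant_def
proof (intro allI impI)
  fix v w :: "'i \<Rightarrow> real" and a
  assume w: "\<forall>i\<in>A. w i = v i + a"
  obtain lo hi u where v0: "init v = (lo, hi, u)" by (metis prod_cases3)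
  have w0: "init w = (lo + a, hi + a, u + a)"
    using assms w v0 unfolding equivariant_init_def by fastforce
  obtain lo' hi' u' where "solver_iterate acc c A v (lo, hi, u) S = (lo', hi', u')"
    by (metis prod_cases3)
  with solver_iterate_shift[of A w v a] w v0 w0
  show "solver acc S init c A w = solver acc S init c A v + a"
    by (simp add: solver_def)
qed

section \<open>Shift equivariance of the shared formula\<close>

lemma block_scale_shift:
  assumes "\<And>i. i \<in> A \<Longrightarrow> w i = v i + a"
  shows "block_scale c a_min A w (m + a) = block_scale c a_min A v m"
  unfolding block_scale_def using assms by (simp cong: mean_over_cong)

text \<open>Kept abstract in the locations and medians, so that exact minimizers and solver outputs
  are instances of one argument.\<close>

lemma rovr_formula_shift:
  fixes \<l> :: "real ^ 't"
  assumes loc: "\<And>b. b \<in> {1..B} \<Longrightarrow> shift_equivariant (H b) (loc b)"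
    and med\<^sub>\<mu>: "shift_equivariant {1..B} med\<^sub>\<mu>"
    and med\<^sub>\<nu>: "shift_equivariant {1..B} med\<^sub>\<nu>"
  shows "rovr_formula c \<gamma> a_min \<nu>_min \<nu>_max B H K loc med\<^sub>\<mu> med\<^sub>\<nu> (\<l> + a *\<^sub>R 1) =
         rovr_formula c \<gamma> a_min \<nu>_min \<nu>_max B H K loc med\<^sub>\<mu> med\<^sub>\<nu> \<l> + a"
proof -
  let ?v = "vec_nth \<l>" and ?w = "vec_nth (\<l> + a *\<^sub>R 1)"
  have w: "?w t = ?v t + a" for t by simp
  have \<mu>: "loc b ?w = loc b ?v + a" if "b \<in> {1..B}" for b
    by (rule shift_equivariantD[OF loc[OF that] w])
  have \<mu>\<^sub>0: "med\<^sub>\<mu> (\<lambda>b. loc b ?w) = med\<^sub>\<mu> (\<lambda>b. loc b ?v) + a"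
    by (rule shift_equivariantD[OF med\<^sub>\<mu> \<mu>])
  \<comment> \<open>The two families of block scales are known to agree only for \<open>b\<close> in
    \<open>{1..B}\<close>, hence the congruence form of equivariance.\<close>
  have \<nu>: "med\<^sub>\<nu> (\<lambda>b. block_scale c a_min (H b) ?w (loc b ?w)) =
           med\<^sub>\<nu> (\<lambda>b. block_scale c a_min (H b) ?v (loc b ?v))"
    by (rule shift_equivariant_cong[OF med\<^sub>\<nu>]) (simp only: \<mu> block_scale_shift[OF w])
  \<comment> \<open>Here \<open>m\<close> stands for the unshifted center, \<open>x b k\<close> for
    the scaled quantile and \<open>y k\<close> for the level; \<open>a\<close> cancels between block
    location and center.\<close>
  have steps: "(\<Sum>b=1..B. \<Sum>k=1..K. logistic_step \<gamma> (loc b ?w - (m + a) - x b k) - y k) =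
      (\<Sum>b=1..B. \<Sum>k=1..K. logistic_step \<gamma> (loc b ?v - m - x b k) - y k)" for m x y
    by (intro sum.cong refl) (simp only: \<mu> add_diff_cancel_right)
  show ?thesis
    unfolding rovr_formula_def Let_def \<mu>\<^sub>0 \<nu> steps by simp
qed

section \<open>Sum of the partial derivatives\<close>

lemma sum_partial_deriv_eq_1:
  fixes F :: "real ^ 't::finite \<Rightarrow> real"
  assumes shift: "\<And>a. F (x + a *\<^sub>R 1) = F x + a" and "F differentiable (at x)"
  shows "(\<Sum>t\<in>UNIV. partial_deriv F t x) = 1"
proof -
  obtain F' where F': "(F has_derivative F') (at x)"
    using assms(2) by (auto simp: differentiable_def)
  then interpret F': bounded_linear F' by (rule has_derivative_bounded_linear)
  \<comment> \<open>The chain rule along the line through \<open>x\<close> in direction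
    \<open>d\<close>; it serves both the coordinate axes and the all-ones vector.\<close>
  have dir: "((\<lambda>s. F (x + s *\<^sub>R d)) has_real_derivative F' d) (at 0)" for d
  proof -
    have "((\<lambda>s. x + s *\<^sub>R d) has_derivative (\<lambda>s. s *\<^sub>R d)) (at 0)"
      by (auto intro!: derivative_eq_intros)
    moreover have "(F has_derivative F') (at (x + 0 *\<^sub>R d))" using F' by simp
    ultimately have "((\<lambda>s. F (x + s *\<^sub>R d)) has_derivative (\<lambda>s. F' (s *\<^sub>R d))) (at 0)"
      by (rule has_derivative_compose)
    then show ?thesis
      by (simp add: F'.scaleR has_field_derivative_def mult_commute_abs)
  qed
  have "(\<Sum>t\<in>UNIV. partial_deriv F t x) = (\<Sum>t\<in>UNIV. F' (axis t 1))"
    unfolding partial_deriv_def using DERIV_imp_deriv[OF dir] by simp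
  also have "\<dots> = F' (\<Sum>t\<in>UNIV. axis t 1)" by (simp add: F'.sum)
  also have "(\<Sum>t\<in>UNIV. axis t 1) = (1 :: real ^ 't)"
    by (simp add: vec_eq_iff axis_def)
  \<comment> \<open>Along the all-ones vector \<open>F\<close> equals \<open>F x + s\<close>, whose
    derivative at 0 is computed twice, by \<open>dir\<close> and directly.\<close>
  also have "F' 1 = 1"
  proof (rule DERIV_unique)
    show "((\<lambda>s. F x + s) has_real_derivative F' 1) (at 0)" using dir[of 1] by (simp add: shift)
    show "((\<lambda>s. F x + s) has_real_derivative 1) (at 0)" by (auto intro!: derivative_eq_intros)
  qed
  finally show ?thesis .
qed

section \<open>Log-scale error and clipping branches\<close>

lemma clip_branch_exp_neq_imp:
  assumes "clip_branch l u (exp x) \<noteq> clip_branch l u (exp y)"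
  shows "infdist y {ln l, ln u} \<le> \<bar>x - y\<bar>"
proof -
  \<comment> \<open>Different branches force a boundary to lie between \<open>x\<close> and
    \<open>y\<close>, endpoints included, hence within their distance of \<open>y\<close>.\<close>
  have "\<exists>z\<in>{ln l, ln u}. dist y z \<le> \<bar>x - y\<bar>"
    using assms by (auto simp: clip_branch_def dist_real_def split: if_splits)
  then show ?thesis by (meson infdist_le order_trans)
qed

theorem proposition4p3:
  fixes c \<gamma> \<eta> a_min \<nu>_min \<nu>_max :: real
    and B K :: nat
    and H :: "nat \<Rightarrow> 't::finite set"
    and F :: "real ^ 't \<Rightarrow> real"
  assumes "c > 0" and "\<gamma> > 0" and "\<eta> > 0" and "a_min > 0"
    and "0 < \<nu>_min" and "\<nu>_min \<le> \<nu>_max"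
    and "B \<ge> 1" and "K \<ge> 1"
    and "balanced_blocks B H"
    and "F = SoftRoVR c \<gamma> \<eta> a_min \<nu>_min \<nu>_max B H K \<or>
         (\<exists>S acc init_loc init\<^sub>\<mu> init\<^sub>\<nu>.
            (\<forall>b\<in>{1..B}. equivariant_init (H b) (init_loc b)) \<and>
            equivariant_init {1..B} init\<^sub>\<mu> \<and>
            equivariant_init {1..B} init\<^sub>\<nu> \<and>
            F = SoftRoVR_finite S acc init_loc init\<^sub>\<mu> init\<^sub>\<nu> c \<gamma> \<eta> a_min \<nu>_min \<nu>_max B H K)"
  shows "(\<forall>(\<l> :: real ^ 't) (a :: real). F (\<l> + a *\<^sub>R 1) = F \<l> + a) \<and>
         (\<forall>\<l> :: real ^ 't. F differentiable (at \<l>) \<longrightarrow>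
            (\<Sum>t\<in>UNIV. partial_deriv F t \<l>) = 1) \<and>
         (\<forall>m_hat m_star e_m :: real.
            e_m \<ge> 0 \<and> \<bar>m_hat - m_star\<bar> \<le> e_m \<longrightarrow>
            exp (- e_m) \<le> exp m_hat / exp m_star \<and>
            exp m_hat / exp m_star \<le> exp e_m \<and>
            (\<forall>l u :: real. 0 < l \<and> l < u \<longrightarrow>
               clip_branch l u (exp m_hat) \<noteq> clip_branch l u (exp m_star) \<longrightarrow>
               infdist m_star {ln l, ln u} \<le> e_m))"
proof (intro conjI allI impI)
  show shift: "F (\<l> + a *\<^sub>R 1) = F \<l> + a" for \<l> a
  proof -
    have ne: "H b \<noteq> {}" if "b \<in> {1..B}" for b
      using assms(9) that by (auto simp: balanced_blocks_def)
    \<comment> \<open>The smooth median is an \<open>m_location\<close> over \<open>{1..B}\<close>,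
      which is nonempty because \<open>B \<ge> 1\<close>.\<close>
    have med: "shift_equivariant {1..B} (smed \<eta> B)"
      using shift_equivariant_m_location[of \<eta> "{1..B}"] assms(3,7)
      by (simp add: smed_def[abs_def])
    from assms(10) show ?thesis
    proof (elim disjE exE conjE)
      assume "F = SoftRoVR c \<gamma> \<eta> a_min \<nu>_min \<nu>_max B H K"
      then show ?thesis
        unfolding SoftRoVR_def
        by (simp only:) (intro rovr_formula_shift shift_equivariant_m_location assms(1) ne med finite)
    next
      fix S acc init_loc init\<^sub>\<mu> init\<^sub>\<nu>
      assume "\<forall>b\<in>{1..B}. equivariant_init (H b) (init_loc b)"
        "equivariant_init {1..B} init\<^sub>\<mu>" "equivariant_init {1..B} init\<^sub>\<nu>"
        "F = SoftRoVR_finite S acc init_loc init\<^sub>\<mu> init\<^sub>\<nu> c \<gamma> \<eta> a_min \<nu>_min \<nu>_max B H K"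
      then show ?thesis
        unfolding SoftRoVR_finite_def
        by (simp only:) (intro rovr_formula_shift shift_equivariant_solver; blast)
    qed
  qed
  show "(\<Sum>t\<in>UNIV. partial_deriv F t \<l>) = 1" if "F differentiable (at \<l>)" for \<l>
    using shift that by (rule sum_partial_deriv_eq_1)
next
  fix m_hat m_star e_m :: real
  assume e: "e_m \<ge> 0 \<and> \<bar>m_hat - m_star\<bar> \<le> e_m"
  \<comment> \<open>The ratio is \<open>exp (m_hat - m_star)\<close>, with exponent between
    \<open>- e_m\<close> and \<open>e_m\<close>.\<close>
  show "exp (- e_m) \<le> exp m_hat / exp m_star" "exp m_hat / exp m_star \<le> exp e_m"
    using e by (auto simp flip: exp_diff)
  show "infdist m_star {ln l, ln u} \<le> e_m"
    if "clip_branch l u (exp m_hat) \<noteq> clip_branch l u (exp m_star)" for l u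
    using clip_branch_exp_neq_imp[OF that] e by linarith
qed

end
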